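(* Let $\ell\ge 5$ and let $\vec C$ be an orientation of the cycle $C_\ell$. If $G$ is a graph with $m(G)<m_2(C_\ell)$, then $G\not\to\vec C$, i.e., $G$ has an orientation containing no copy of $\vec C$.
   Context: $m(G)=\max\{e(J)/v(J):J\subseteq G,\ v(J)\ge1\}$ and $m_2(G)=\max\{(e(J)-1)/(v(J)-2):J\subseteq G,\ v(J)\ge3\}$; in particular $m_2(C_\ell)=(\ell-1)/(\ell-2)$. *)

theory Defs
  imports Complex_Main
begin

type_synonym 'a graph = "'a set \<times> 'a set set"
type_synonym 'a digraph = "'a set \<times> ('a \<times> 'a) set"

abbreviation verts :: "'a graph \<Rightarrow> 'a set" where "verts G \<equiv> fst G"
abbreviation edges :: "'a graph \<Rightarrow> 'a set set" where "edges G \<equiv> snd G"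
abbreviation dverts :: "'a digraph \<Rightarrow> 'a set" where "dverts D \<equiv> fst D"
abbreviation arcs :: "'a digraph \<Rightarrow> ('a \<times> 'a) set" where "arcs D \<equiv> snd D"

definition simple_graph :: "'a graph \<Rightarrow> bool" where
  "simple_graph G \<longleftrightarrow> finite (verts G) \<and> (\<forall>e\<in>edges G. e \<subseteq> verts G \<and> card e = 2)"

definition subgraph :: "'a graph \<Rightarrow> 'a graph \<Rightarrow> bool" where
  "subgraph J G \<longleftrightarrow> simple_graph J \<and> verts J \<subseteq> verts G \<and> edges J \<subseteq> edges G"

text \<open>The value is unspecified when \<open>G\<close> has no vertices.\<close>

definition max_density :: "'a graph \<Rightarrow> real" where
  "max_density G =
     Max {real (card (edges J)) / real (card (verts J)) | J.
            subgraph J G \<and> card (verts J) \<ge> 1}"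

text \<open>The value is unspecified when \<open>G\<close> has fewer than three vertices.\<close>

definition max_2_density :: "'a graph \<Rightarrow> real" where
  "max_2_density G =
     Max {(real (card (edges J)) - 1) / (real (card (verts J)) - 2) | J.
            subgraph J G \<and> card (verts J) \<ge> 3}"

text \<open>This is the cycle of length \<open>l\<close> only for \<open>l \<ge> 3\<close>.\<close>

definition cycle_graph :: "nat \<Rightarrow> nat graph" where
  "cycle_graph l = ({..<l}, {{i, (i + 1) mod l} | i. i < l})"

definition orientation_of :: "'a digraph \<Rightarrow> 'a graph \<Rightarrow> bool" where
  "orientation_of D G \<longleftrightarrow>
     dverts D = verts G \<and>
     (\<forall>u v. (u, v) \<in> arcs D \<longrightarrow> {u, v} \<in> edges G) \<and>
     (\<forall>u v. {u, v} \<in> edges G \<longrightarrow> ((u, v) \<in> arcs D \<longleftrightarrow> (v, u) \<notin> arcs D))"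

text \<open>Copies are not required to be induced.\<close>

definition contains_copy :: "'a digraph \<Rightarrow> 'b digraph \<Rightarrow> bool" where
  "contains_copy D H \<longleftrightarrow>
     (\<exists>f. inj_on f (dverts H) \<and> f ` dverts H \<subseteq> dverts D \<and>
          (\<forall>(u, v)\<in>arcs H. (f u, f v) \<in> arcs D))"

text \<open>The relation \<open>G \<rightarrow> H\<close>.\<close>

definition arrows :: "'a graph \<Rightarrow> 'b digraph \<Rightarrow> bool" where
  "arrows G H \<longleftrightarrow> (\<forall>D. orientation_of D G \<longrightarrow> contains_copy D H)"

end

theory Submission
  imports Defs
begin

text \<open>The density bound makes \<open>G\<close> 2-degenerate, hence 3-colourable. Orienting every edge towards the
  larger colour leaves no directed path with three edges, which settles every cycle \<open>C\<close> having a
  block (maximal directed subpath) of length at least three.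

  If all blocks of \<open>C\<close> have length at most two, delete a small configuration from \<open>G\<close>, orient the
  rest by induction, and extend so that no copy of \<open>C\<close> meets the configuration. A vertex of degree at
  most one lies on no cycle. Two adjacent vertices of degree two can be made inner vertices of a
  directed path with three edges. Discharging finds one of these two when \<open>l \<ge> 7\<close>. For \<open>l \<le> 6\<close> there
  may instead be a vertex \<open>x\<close> of degree three with neighbours \<open>y1\<close>, \<open>y2\<close> of degree two and \<open>w\<close>.
  The orientation \<open>z1 \<rightarrow> y1 \<rightarrow> x \<rightarrow> w\<close>, \<open>z2 \<rightarrow> y2 \<rightarrow> x\<close> only allows copies in which two blocks of length
  two meet head to head at \<open>x\<close>, the reversed orientation only those where they meet tail to tail,
  and a cycle of length at most six cannot have both.\<close>

section \<open>Sparse graphs and unrolled oriented cycles\<close>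

definition neighbours :: "'a set set \<Rightarrow> 'a \<Rightarrow> 'a set" where
  "neighbours E v = {u. {u, v} \<in> E}"

text \<open>The integer form of m(G) < (k + 1) / k, tested on induced subgraphs. At
  \<open>k = l - 2\<close> this bound is m_2 of the cycle of length \<open>l\<close>.\<close>

definition sparse :: "nat \<Rightarrow> 'a set \<Rightarrow> 'a set set \<Rightarrow> bool" where
  "sparse k V E \<longleftrightarrow>
     (\<forall>S\<subseteq>V. S \<noteq> {} \<longrightarrow> k * card {e \<in> E. e \<subseteq> S} < (k + 1) * card S)"

text \<open>The direction is a parameter so that one argument serves a configuration and its
  reversal.\<close>

definition arc_dir :: "('a \<times> 'a) set \<Rightarrow> bool \<Rightarrow> 'a \<Rightarrow> 'a \<Rightarrow> bool" where
  "arc_dir A b x y \<longleftrightarrow> (if b then (x, y) \<in> A else (y, x) \<in> A)"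

text \<open>The cycle is unrolled: \<open>f\<close> has period \<open>l\<close>, and \<open>s i\<close> says whether the edge from position
  \<open>i\<close> to \<open>i + 1\<close> points forwards.\<close>

definition cycle_copy ::
    "('a \<times> 'a) set \<Rightarrow> nat \<Rightarrow> (nat \<Rightarrow> bool) \<Rightarrow> (nat \<Rightarrow> 'a) \<Rightarrow> bool" where
  "cycle_copy A l s f \<longleftrightarrow> inj_on f {..<l} \<and> (\<forall>i. f (i + l) = f i) \<and>
     (\<forall>i. arc_dir A (s i) (f i) (f (Suc i)))"

section \<open>Simple graphs, degrees and discharging\<close>

lemma finite_edges: "simple_graph (V, E) \<Longrightarrow> finite E"
  by (rule finite_subset[of _ "Pow V"]) (auto simp: simple_graph_def)

lemma edge_distinct: "simple_graph (V, E) \<Longrightarrow> {u, v} \<in> E \<Longrightarrow> u \<noteq> v"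
  by (force simp: simple_graph_def)

lemma edge_in_verts: "simple_graph (V, E) \<Longrightarrow> {u, v} \<in> E \<Longrightarrow> u \<in> V \<and> v \<in> V"
  by (force simp: simple_graph_def)

lemma edge_other_end:
  assumes "simple_graph (V, E)" "e \<in> E" "v \<in> e"
  obtains u where "e = {u, v}" "u \<noteq> v"
proof -
  from assms have "card e = 2" by (auto simp: simple_graph_def)
  then show ?thesis using that assms(3) by (auto simp: card_2_iff)
qed

lemma neighbours_subset: "simple_graph (V, E) \<Longrightarrow> neighbours E v \<subseteq> V"
  by (auto simp: neighbours_def dest: edge_in_verts)

lemma finite_neighbours: "simple_graph (V, E) \<Longrightarrow> finite (neighbours E v)"
  by (rule finite_subset[OF neighbours_subset, of V]) (simp_all add: simple_graph_def)

lemma neighbours_sym: "u \<in> neighbours E v \<longleftrightarrow> v \<in> neighbours E u"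
  by (simp add: neighbours_def insert_commute)

text \<open>Handshake by double counting of incidences; \<open>deg\<close> identifies the neighbours
  of \<open>v\<close> with the edges at \<open>v\<close>.\<close>

lemma sum_degrees:
  assumes "simple_graph (V, E)"
  shows "(\<Sum>v\<in>V. card (neighbours E v)) = 2 * card E"
proof -
  have fV: "finite V" using assms by (simp add: simple_graph_def)
  note fE = finite_edges[OF assms]
  have deg: "card (neighbours E v) = card {e \<in> E. v \<in> e}" for v
  proof (rule bij_betw_same_card[of "\<lambda>u. {u, v}"], rule bij_betwI')
    fix x y assume "x \<in> neighbours E v" "y \<in> neighbours E v"
    then show "({x, v} = {y, v}) = (x = y)" by (auto simp: doubleton_eq_iff)
  next
    fix x assume "x \<in> neighbours E v"
    then show "{x, v} \<in> {e \<in> E. v \<in> e}" by (simp add: neighbours_def)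
  next
    fix e assume "e \<in> {e \<in> E. v \<in> e}"
    then show "\<exists>x\<in>neighbours E v. e = {x, v}"
      using edge_other_end[OF assms, of e v] by (auto simp: neighbours_def)
  qed
  have "(\<Sum>v\<in>V. card (neighbours E v)) = (\<Sum>v\<in>V. \<Sum>e | e \<in> E \<and> v \<in> e. 1)"
    by (simp add: deg)
  also have "\<dots> = (\<Sum>e\<in>E. \<Sum>v | v \<in> V \<and> v \<in> e. 1)"
    using fV fE by (rule sum.swap_restrict)
  also have "\<dots> = (\<Sum>e\<in>E. 2)"
  proof (rule sum.cong)
    fix e assume "e \<in> E"
    then have "e \<subseteq> V" "card e = 2" using assms by (auto simp: simple_graph_def)
    moreover from this have "{v. v \<in> V \<and> v \<in> e} = e" by auto
    ultimately show "(\<Sum>v | v \<in> V \<and> v \<in> e. 1) = (2::nat)" by simp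
  qed simp
  finally show ?thesis by simp
qed

text \<open>Discharging: a vertex \<open>v\<close> has charge \<open>k deg v - (2 k + 2)\<close>, and every vertex gives one
  unit to each neighbour of degree two.\<close>

lemma discharge_degree_two:
  fixes k :: nat
  assumes G: "simple_graph (V, E)"
    and indep: "\<And>u v. {u, v} \<in> E \<Longrightarrow> card (neighbours E u) = 2 \<Longrightarrow> card (neighbours E v) \<noteq> 2"
    and big: "\<And>v. v \<in> V \<Longrightarrow> card (neighbours E v) \<noteq> 2 \<Longrightarrow>
      card {u \<in> neighbours E v. card (neighbours E u) = 2} + (2 * k + 2) \<le> k * card (neighbours E v)"
  shows "(k + 1) * card V \<le> k * card E"
proof -
  let ?d = "\<lambda>v. card (neighbours E v)"
  let ?n = "\<lambda>v. card {u \<in> neighbours E v. ?d u = 2}"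
  define S where "S = {v \<in> V. ?d v = 2}"
  have fV: "finite V" using G by (simp add: simple_graph_def)
  have fS: "finite S" "finite (V - S)" "S \<subseteq> V" using fV by (auto simp: S_def)
  \<comment> \<open>Double counting of the edges between \<open>S\<close> and its complement: by
    \<open>indep\<close>, both neighbours of a vertex of \<open>S\<close> lie outside
    \<open>S\<close>.\<close>
  have "(\<Sum>v\<in>S. 2) = (\<Sum>v\<in>S. \<Sum>u | u \<in> V - S \<and> u \<in> neighbours E v. 1::nat)"
  proof (rule sum.cong)
    fix v assume v: "v \<in> S"
    have "{u. u \<in> V - S \<and> u \<in> neighbours E v} = neighbours E v"
      using v indep neighbours_subset[OF G, of v] by (auto simp: S_def neighbours_def)
    then show "2 = (\<Sum>u | u \<in> V - S \<and> u \<in> neighbours E v. 1::nat)"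
      using v by (simp add: S_def)
  qed simp
  also have "\<dots> = (\<Sum>u\<in>V - S. \<Sum>v | v \<in> S \<and> u \<in> neighbours E v. 1)"
    by (rule sum.swap_restrict) (use fS in auto)
  also have "\<dots> = (\<Sum>u\<in>V - S. ?n u)"
  proof (rule sum.cong)
    fix u
    have "{v. v \<in> S \<and> u \<in> neighbours E v} = {v \<in> neighbours E u. ?d v = 2}"
      using neighbours_subset[OF G, of u] by (auto simp: S_def neighbours_sym[of u])
    then show "(\<Sum>v | v \<in> S \<and> u \<in> neighbours E v. 1) = ?n u" by simp
  qed simp
  finally have count: "2 * card S = (\<Sum>u\<in>V - S. ?n u)" by simp
  \<comment> \<open>Vertices outside \<open>S\<close> keep nonnegative charge by \<open>big\<close>.
    A vertex of \<open>S\<close> starts with 2k - (2k + 2) = -2, which the two units it receives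
    cancel.\<close>
  have "(\<Sum>u\<in>V - S. ?n u + (2 * k + 2)) \<le> (\<Sum>u\<in>V - S. k * ?d u)"
    by (rule sum_mono) (use big in \<open>auto simp: S_def\<close>)
  then have "2 * card S + (2 * k + 2) * card (V - S) \<le> (\<Sum>u\<in>V - S. k * ?d u)"
    unfolding sum.distrib count by (simp add: mult.commute)
  moreover have "(\<Sum>u\<in>S. k * ?d u) = 2 * k * card S"
    by (simp add: S_def)
  moreover have "(\<Sum>u\<in>V. k * ?d u) = (\<Sum>u\<in>V - S. k * ?d u) + (\<Sum>u\<in>S. k * ?d u)"
    using fV fS by (simp add: sum.subset_diff)
  moreover have "(\<Sum>u\<in>V. k * ?d u) = 2 * k * card E"
    using sum_degrees[OF G] by (simp flip: sum_distrib_left)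
  moreover have "card V = card (V - S) + card S"
    using fV fS by (metis card_Diff_subset card_mono le_add_diff_inverse2)
  ultimately have "2 * ((k + 1) * card V) \<le> 2 * (k * card E)"
    by (simp add: algebra_simps)
  then show ?thesis by simp
qed

section \<open>Sparseness, low degree and three-colouring\<close>

lemma simple_graph_delete:
  "simple_graph (V, E) \<Longrightarrow> simple_graph (V - X, {e \<in> E. e \<inter> X = {}})"
  by (auto simp: simple_graph_def)

lemma sparse_delete:
  assumes "sparse k V E"
  shows "sparse k (V - X) {e \<in> E. e \<inter> X = {}}"
  unfolding sparse_def
proof (intro allI impI)
  fix S assume S: "S \<subseteq> V - X" "S \<noteq> {}"
  have "{e \<in> {e \<in> E. e \<inter> X = {}}. e \<subseteq> S} = {e \<in> E. e \<subseteq> S}" using S by auto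
  then show "k * card {e \<in> {e \<in> E. e \<inter> X = {}}. e \<subseteq> S} < (k + 1) * card S"
    using assms[unfolded sparse_def, rule_format, of S] S by (metis Diff_subset subset_trans)
qed

lemma sparse_whole:
  assumes "simple_graph (V, E)" "sparse k V E" "V \<noteq> {}"
  shows "k * card E < (k + 1) * card V"
proof -
  have "{e \<in> E. e \<subseteq> V} = E" using assms(1) by (auto simp: simple_graph_def)
  then show ?thesis using assms unfolding sparse_def by (metis subset_refl)
qed

text \<open>Minimum degree three would give at least 3/2 edges per vertex, but sparseness allows
  fewer than (k + 1) / k, which is at most 3/2.\<close>

lemma sparse_low_degree:
  assumes G: "simple_graph (V, E)" and sp: "sparse k V E" and V: "V \<noteq> {}" and k: "k \<ge> 2"
  obtains v where "v \<in> V" "card (neighbours E v) \<le> 2"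
proof (rule ccontr)
  assume "\<not> thesis"
  then have "\<And>v. v \<in> V \<Longrightarrow> 3 \<le> card (neighbours E v)" using that by force
  then have "(\<Sum>v\<in>V. 3) \<le> (\<Sum>v\<in>V. card (neighbours E v))" by (rule sum_mono)
  then have "3 * card V \<le> 2 * card E" by (simp add: sum_degrees[OF G])
  from mult_left_mono[OF this, of k] have "3 * (k * card V) \<le> 2 * (k * card E)"
    by (simp only: mult.left_commute)
  moreover have "k * card E < k * card V + card V" using sparse_whole[OF G sp V] by simp
  moreover have "2 * card V \<le> k * card V" using k by simp
  ultimately show False by linarith
qed

text \<open>Greedy colouring: a vertex of degree at most two is removed, and its neighbours block at
  most two of the three colours.\<close>

lemma sparse_three_colouring:
  assumes "simple_graph (V, E)" "sparse k V E" "k \<ge> 2"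
  shows "\<exists>c :: 'a \<Rightarrow> nat. (\<forall>v. c v < 3) \<and> (\<forall>u v. {u, v} \<in> E \<longrightarrow> c u \<noteq> c v)"
  using assms
proof (induction "card V" arbitrary: V E rule: less_induct)
  case less
  show ?case
  proof (cases "V = {}")
    case True
    then have "E = {}" using less.prems(1) by (force simp: simple_graph_def)
    then show ?thesis by (intro exI[of _ "\<lambda>_. 0"]) simp
  next
    case False
    obtain v where v: "v \<in> V" "card (neighbours E v) \<le> 2"
      using sparse_low_degree[OF less.prems(1,2) False less.prems(3)] .
    have "finite V" using less.prems by (simp add: simple_graph_def)
    then have "card (V - {v}) < card V" using v(1) by (rule card_Diff1_less)
    from less.hyps[OF this simple_graph_delete[OF less.prems(1)] sparse_delete[OF less.prems(2)]
        less.prems(3)]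
    obtain c :: "'a \<Rightarrow> nat" where c: "\<And>v. c v < 3"
      "\<And>x y. {x, y} \<in> E \<Longrightarrow> {x, y} \<inter> {v} = {} \<Longrightarrow> c x \<noteq> c y" by auto
    have "card (c ` neighbours E v) < card {..<3::nat}"
      using card_image_le[OF finite_neighbours[OF less.prems(1)], of c v] v by simp
    moreover have "finite (c ` neighbours E v)" using finite_neighbours[OF less.prems(1)] by simp
    ultimately have "\<not> {..<3} \<subseteq> c ` neighbours E v" by (meson card_mono not_le)
    then obtain a where a: "a < 3" "a \<notin> c ` neighbours E v" by auto
    show ?thesis
    proof (intro exI[of _ "c(v := a)"] conjI allI impI)
      show "(c(v := a)) x < 3" for x using a c by simp
      fix x y assume xy: "{x, y} \<in> E"
      then have "x \<noteq> y" by (rule edge_distinct[OF less.prems(1)])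
      then show "(c(v := a)) x \<noteq> (c(v := a)) y"
        using xy a c(2)[of x y] by (auto simp: neighbours_def insert_commute)
    qed
  qed
qed

section \<open>Directions of edges and cycles with a long block\<close>

lemma arc_dir_edge:
  "orientation_of (V, A) (V, E) \<Longrightarrow> arc_dir A b x y \<Longrightarrow> {x, y} \<in> E"
  unfolding orientation_of_def arc_dir_def by (metis insert_commute snd_conv)

lemma arc_dir_flip: "arc_dir A (\<not> b) y x \<longleftrightarrow> arc_dir A b x y"
  by (simp add: arc_dir_def)

lemma arc_dir_unique:
  "orientation_of (V, A) (V, E) \<Longrightarrow> arc_dir A b x y \<Longrightarrow> arc_dir A c x y \<Longrightarrow> b = c"
  using arc_dir_edge[of V A E b x y]
  unfolding orientation_of_def arc_dir_def by (metis snd_conv)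

lemma long_block_avoidable:
  assumes "simple_graph (V, E)" "sparse k V E" "k \<ge> 2"
    and s: "s i = s (Suc i)" "s i = s (Suc (Suc i))"
  shows "\<exists>A. orientation_of (V, A) (V, E) \<and> (\<forall>f. \<not> cycle_copy A l s f)"
proof -
  obtain c :: "'a \<Rightarrow> nat" where c: "\<And>v. c v < 3" "\<And>u v. {u, v} \<in> E \<Longrightarrow> c u \<noteq> c v"
    using sparse_three_colouring[OF assms(1-3)] by blast
  define A where "A = {(u, v). {u, v} \<in> E \<and> c u < c v}"
  have "orientation_of (V, A) (V, E)"
    using c(2) unfolding orientation_of_def A_def
    by (auto simp: insert_commute dest: nat_neq_iff[THEN iffD1])
  moreover have "\<not> cycle_copy A l s f" for f
  proof
    assume "cycle_copy A l s f"
    then have step: "arc_dir A (s j) (f j) (f (Suc j))" for j by (simp add: cycle_copy_def)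
    have "arc_dir A (s i) (f i) (f (Suc i))" "arc_dir A (s i) (f (Suc i)) (f (Suc (Suc i)))"
      "arc_dir A (s i) (f (Suc (Suc i))) (f (Suc (Suc (Suc i))))"
      using step[of i] step[of "Suc i"] step[of "Suc (Suc i)"] by (simp_all add: s[symmetric])
    moreover have "arc_dir A b x y \<Longrightarrow> if b then c x < c y else c y < c x" for b x y
      by (cases b) (simp_all add: arc_dir_def A_def)
    \<comment> \<open>Four consecutive vertices get strictly monotone colours, impossible with 0, 1,
      2.\<close>
    ultimately have "if s i then c (f i) < c (f (Suc i)) \<and> c (f (Suc i)) < c (f (Suc (Suc i))) \<and>
        c (f (Suc (Suc i))) < c (f (Suc (Suc (Suc i))))
      else c (f (Suc i)) < c (f i) \<and> c (f (Suc (Suc i))) < c (f (Suc i)) \<and>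
        c (f (Suc (Suc (Suc i)))) < c (f (Suc (Suc i)))"
      by metis
    then show False
      using c(1)[of "f i"] c(1)[of "f (Suc (Suc (Suc i)))"] by (auto split: if_splits)
  qed
  ultimately show ?thesis by blast
qed

section \<open>Local structure of a copy around a vertex\<close>

text \<open>Indices two apart differ modulo \<open>l\<close>, since \<open>l\<close> does not divide
  2.\<close>

lemma cycle_copy_skip:
  assumes "cycle_copy A l s f" "l \<ge> 3"
  shows "f i \<noteq> f (Suc (Suc i))"
proof
  have per: "f (i + n * l) = f i" for i n
  proof (induction n)
    case (Suc n)
    have "f (i + Suc n * l) = f (i + n * l + l)" by (simp add: ac_simps)
    also have "\<dots> = f (i + n * l)" using assms(1) unfolding cycle_copy_def by blast
    finally show ?case using Suc by simp
  qed simp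
  have red: "f i = f (i mod l)" for i
    using per[of "i mod l" "i div l"] by simp
  assume "f i = f (Suc (Suc i))"
  then have "f (i mod l) = f ((i + 2) mod l)" using red[of i] red[of "i + 2"] by simp
  then have "i mod l = (i + 2) mod l"
    using assms by (auto simp: cycle_copy_def dest: inj_onD)
  then have "l dvd 2" by (metis add_diff_cancel_left' le_add1 mod_eq_dvd_iff_nat)
  then show False using assms(2) by (auto dest: dvd_imp_le)
qed

text \<open>Periodicity moves any index beyond 2, so that local arguments can look up to three
  positions back without subtraction.\<close>

lemma cycle_copy_late:
  assumes "cycle_copy A l s f" "l \<ge> 3"
  obtains j where "f (Suc (Suc (Suc j))) = f i"
proof -
  have "f (i + l) = f i" using assms by (simp add: cycle_copy_def)
  moreover have "i + l = Suc (Suc (Suc (i + l - 3)))" using assms by simp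
  ultimately show thesis using that by metis
qed

lemma cycle_copy_neighbours:
  assumes "orientation_of (V, A) (V, E)" "cycle_copy A l s f" "l \<ge> 3"
  shows "f i \<in> neighbours E (f (Suc i))" "f (Suc (Suc i)) \<in> neighbours E (f (Suc i))"
    "f i \<noteq> f (Suc (Suc i))"
proof -
  have step: "{f i, f (Suc i)} \<in> E" for i
    using arc_dir_edge[OF assms(1)] assms(2) unfolding cycle_copy_def by blast
  show "f i \<in> neighbours E (f (Suc i))" using step by (simp add: neighbours_def)
  show "f (Suc (Suc i)) \<in> neighbours E (f (Suc i))"
    using step[of "Suc i"] by (simp add: neighbours_def insert_commute)
  show "f i \<noteq> f (Suc (Suc i))" using assms(2,3) by (rule cycle_copy_skip)
qed

section \<open>Extending an orientation over a deleted configuration\<close>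

lemma extend_orientation:
  assumes A': "orientation_of (V - X, A') (V - X, {e \<in> E. e \<inter> X = {}})"
    and B: "\<And>u v. (u, v) \<in> B \<Longrightarrow> {u, v} \<in> E \<and> {u, v} \<inter> X \<noteq> {} \<and> (v, u) \<notin> B"
    and cover: "\<And>u v. {u, v} \<in> E \<Longrightarrow> v \<in> X \<Longrightarrow> (u, v) \<in> B \<or> (v, u) \<in> B"
  shows "orientation_of (V, A' \<union> B) (V, E)"
proof -
  have a: "{u, v} \<in> E \<and> {u, v} \<inter> X = {}" if "(u, v) \<in> A'" for u v
    using A' that unfolding orientation_of_def by (metis (mono_tags, lifting) mem_Collect_eq snd_conv)
  have b: "(u, v) \<in> A' \<longleftrightarrow> (v, u) \<notin> A'" if "{u, v} \<in> E" "{u, v} \<inter> X = {}" for u v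
    using A' that unfolding orientation_of_def by (metis (mono_tags, lifting) mem_Collect_eq snd_conv)
  have "(u, v) \<in> A' \<union> B \<longleftrightarrow> (v, u) \<notin> A' \<union> B" if e: "{u, v} \<in> E" for u v
  proof (cases "{u, v} \<inter> X = {}")
    case True
    then have "(u, v) \<notin> B" "(v, u) \<notin> B" using B[of u v] B[of v u] by auto
    then show ?thesis using b[OF e True] by blast
  next
    case False
    then have "(u, v) \<notin> A'" "(v, u) \<notin> A'" using a[of u v] a[of v u] by auto
    moreover have "(u, v) \<in> B \<or> (v, u) \<in> B"
      using False cover[of u v] cover[of v u] e by (auto simp: insert_commute)
    ultimately show ?thesis using B[of u v] B[of v u] by blast
  qed
  moreover have "{u, v} \<in> E" if "(u, v) \<in> A' \<union> B" for u v using a B that by blast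
  ultimately show ?thesis unfolding orientation_of_def by simp
qed

text \<open>By \<open>miss\<close> and periodicity, a copy in the enlarged orientation avoids
  \<open>X\<close> altogether, so it uses no arc of \<open>B\<close> and is already a copy in
  \<open>A'\<close>.\<close>

lemma extend_avoiding:
  assumes A': "orientation_of (V - X, A') (V - X, {e \<in> E. e \<inter> X = {}})"
      "\<And>f. \<not> cycle_copy A' l s f"
    and B: "\<And>u v. (u, v) \<in> B \<Longrightarrow> {u, v} \<in> E \<and> {u, v} \<inter> X \<noteq> {} \<and> (v, u) \<notin> B"
    and cover: "\<And>u v. {u, v} \<in> E \<Longrightarrow> v \<in> X \<Longrightarrow> (u, v) \<in> B \<or> (v, u) \<in> B"
    and miss: "\<And>f j. orientation_of (V, A' \<union> B) (V, E) \<Longrightarrow> cycle_copy (A' \<union> B) l s f \<Longrightarrow>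
      f (Suc (Suc (Suc j))) \<in> X \<Longrightarrow> False"
    and l: "l \<ge> 3"
  shows "\<exists>A. orientation_of (V, A) (V, E) \<and> (\<forall>f. \<not> cycle_copy A l s f)"
proof (intro exI[of _ "A' \<union> B"] conjI allI notI)
  show ori: "orientation_of (V, A' \<union> B) (V, E)"
    using A'(1) B cover by (rule extend_orientation)
  fix f assume f: "cycle_copy (A' \<union> B) l s f"
  have out: "f i \<notin> X" for i
    using cycle_copy_late[OF f l, of i] miss[OF ori f] by metis
  have "arc_dir A' (s i) (f i) (f (Suc i))" for i
  proof -
    have "arc_dir (A' \<union> B) (s i) (f i) (f (Suc i))" using f by (simp add: cycle_copy_def)
    then show ?thesis
      using out[of i] out[of "Suc i"] B[of "f i" "f (Suc i)"] B[of "f (Suc i)" "f i"]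
      by (auto simp: arc_dir_def split: if_splits)
  qed
  then have "cycle_copy A' l s f" using f by (simp add: cycle_copy_def)
  then show False using A'(2) by blast
qed

lemma extend_degree_one:
  assumes G: "simple_graph (V, E)" and l: "l \<ge> 3"
    and deg: "card (neighbours E v) \<le> 1"
    and A': "orientation_of (V - {v}, A') (V - {v}, {e \<in> E. e \<inter> {v} = {}})"
      "\<And>f. \<not> cycle_copy A' l s f"
  shows "\<exists>A. orientation_of (V, A) (V, E) \<and> (\<forall>f. \<not> cycle_copy A l s f)"
proof (rule extend_avoiding[OF A', where B = "(\<lambda>u. (u, v)) ` neighbours E v"])
  fix a b assume "(a, b) \<in> (\<lambda>u. (u, v)) ` neighbours E v"
  then show "{a, b} \<in> E \<and> {a, b} \<inter> {v} \<noteq> {} \<and> (b, a) \<notin> (\<lambda>u. (u, v)) ` neighbours E v"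
    using edge_distinct[OF G, of a b] by (auto simp: neighbours_def)
next
  fix a b assume "{a, b} \<in> E" "b \<in> {v}"
  then show "(a, b) \<in> (\<lambda>u. (u, v)) ` neighbours E v \<or> (b, a) \<in> (\<lambda>u. (u, v)) ` neighbours E v"
    by (auto simp: neighbours_def)
next
  let ?A = "A' \<union> (\<lambda>u. (u, v)) ` neighbours E v"
  fix f j assume *: "orientation_of (V, ?A) (V, E)" "cycle_copy ?A l s f"
    "f (Suc (Suc (Suc j))) \<in> {v}"
  have "card {f (Suc (Suc j)), f (Suc (Suc (Suc (Suc j))))} \<le> card (neighbours E v)"
    using cycle_copy_neighbours[OF *(1,2) l, of "Suc (Suc j)"] *(3)
    by (intro card_mono finite_neighbours[OF G]) auto
  then show False using deg cycle_copy_neighbours(3)[OF *(1,2) l, of "Suc (Suc j)"] by simp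
qed (use l in simp)

text \<open>A copy meeting \<open>v1\<close> or \<open>v2\<close> runs through all three edges of
  the path \<open>u, v1, v2, w\<close>, as both inner vertices have degree two. Their common
  direction contradicts \<open>no3\<close>. The ends \<open>u\<close> and \<open>w\<close> may
  coincide.\<close>

lemma extend_degree_two_pair:
  assumes G: "simple_graph (V, E)" and l: "l \<ge> 3"
    and nb: "neighbours E v1 = {u, v2}" "neighbours E v2 = {v1, w}" "u \<noteq> v2" "w \<noteq> v1"
    and no3: "\<And>i. \<not> (s i = s (Suc i) \<and> s i = s (Suc (Suc i)))"
    and A': "orientation_of (V - {v1, v2}, A') (V - {v1, v2}, {e \<in> E. e \<inter> {v1, v2} = {}})"
      "\<And>f. \<not> cycle_copy A' l s f"
  shows "\<exists>A. orientation_of (V, A) (V, E) \<and> (\<forall>f. \<not> cycle_copy A l s f)"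
proof (rule extend_avoiding[OF A', where B = "{(u, v1), (v1, v2), (v2, w)}"])
  have e: "{u, v1} \<in> E" "{v1, v2} \<in> E" "{v2, w} \<in> E"
    using nb unfolding neighbours_def by (auto simp: insert_commute)
  note ne = edge_distinct[OF G e(1)] edge_distinct[OF G e(2)] edge_distinct[OF G e(3)]
  {
    fix a b assume "(a, b) \<in> {(u, v1), (v1, v2), (v2, w)}"
    then show "{a, b} \<in> E \<and> {a, b} \<inter> {v1, v2} \<noteq> {} \<and> (b, a) \<notin> {(u, v1), (v1, v2), (v2, w)}"
      using e ne nb(3,4) by auto
  next
    fix a b assume "{a, b} \<in> E" "b \<in> {v1, v2}"
    then have "b = v1 \<and> a \<in> {u, v2} \<or> b = v2 \<and> a \<in> {v1, w}"
      unfolding nb(1,2)[symmetric] by (auto simp: neighbours_def)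
    then show "(a, b) \<in> {(u, v1), (v1, v2), (v2, w)} \<or> (b, a) \<in> {(u, v1), (v1, v2), (v2, w)}"
      by auto
  next
    let ?A = "A' \<union> {(u, v1), (v1, v2), (v2, w)}"
    fix f j assume ori: "orientation_of (V, ?A) (V, E)" and f: "cycle_copy ?A l s f"
      and hit: "f (Suc (Suc (Suc j))) \<in> {v1, v2}"
    note nbf = cycle_copy_neighbours[OF ori f l]
    have fwd: "f i = x \<Longrightarrow> f (Suc i) = y \<Longrightarrow> (x, y) \<in> ?A \<Longrightarrow> s i" for i x y
      using arc_dir_unique[OF ori, of "s i" x y True] f by (auto simp: cycle_copy_def arc_dir_def)
    have bwd: "f i = y \<Longrightarrow> f (Suc i) = x \<Longrightarrow> (x, y) \<in> ?A \<Longrightarrow> \<not> s i" for i x y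
      using arc_dir_unique[OF ori, of "s i" y x False] f by (auto simp: cycle_copy_def arc_dir_def)
    have thr: "(f i = u \<and> f (Suc (Suc i)) = v2) \<or> (f i = v2 \<and> f (Suc (Suc i)) = u)"
      if "f (Suc i) = v1" for i using nbf[of i] that nb by auto
    have thr': "(f i = v1 \<and> f (Suc (Suc i)) = w) \<or> (f i = w \<and> f (Suc (Suc i)) = v1)"
      if "f (Suc i) = v2" for i using nbf[of i] that nb by auto
    \<comment> \<open>\<open>fw\<close> and \<open>bw\<close> treat the two senses of traversal;
      \<open>h\<close> is the index of the end of the path visited first.\<close>
    have fw: False if "f i = v1" "f (Suc i) = v2" "i > 0" for i
    proof -
      obtain h where h: "i = Suc h" using \<open>i > 0\<close> by (cases i) auto
      have "f h = u" "f (Suc (Suc i)) = w" using thr[of h] thr'[of i] that nb(3,4) h by auto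
      then have "s h" "s (Suc h)" "s (Suc (Suc h))"
        using that h by (auto intro!: fwd)
      then show False using no3[of h] by simp
    qed
    have bw: False if "f i = v2" "f (Suc i) = v1" "i > 0" for i
    proof -
      obtain h where h: "i = Suc h" using \<open>i > 0\<close> by (cases i) auto
      have "f h = w" "f (Suc (Suc i)) = u" using thr'[of h] thr[of i] that nb(3,4) h by auto
      then have "\<not> s h" "\<not> s (Suc h)" "\<not> s (Suc (Suc h))"
        using that h bwd[of h w v2] bwd[of i v2 v1] bwd[of "Suc i" v1 u] by auto
      then show False using no3[of h] by simp
    qed
    show False
      using hit thr[of "Suc (Suc j)"] thr'[of "Suc (Suc j)"] fw[of "Suc (Suc j)"] bw[of "Suc (Suc j)"]
        fw[of "Suc (Suc (Suc j))"] bw[of "Suc (Suc (Suc j))"] by auto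
  }
qed (use l in simp)

text \<open>From \<open>z1, y1, x\<close> the copy goes on to \<open>w\<close>, against
  \<open>no3\<close>, or to \<open>y2, z2\<close>, with directions
  \<open>b, b, \<not> b, \<not> b\<close> against \<open>nopat\<close>. Traversal in the other sense
  reverses the order and negates each direction, which leaves that pattern unchanged.\<close>

lemma copy_misses_tee:
  assumes ori: "orientation_of (V, A) (V, E)" and f: "cycle_copy A l s f" and l: "l \<ge> 3"
    and nb: "neighbours E y1 = {x, z1}" "neighbours E y2 = {x, z2}" "neighbours E x = {y1, y2, w}"
    and arcs: "arc_dir A b z1 y1" "arc_dir A b y1 x" "arc_dir A b z2 y2" "arc_dir A b y2 x"
      "arc_dir A b x w"
    and no3: "\<And>i. \<not> (s i = s (Suc i) \<and> s i = s (Suc (Suc i)))"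
    and nopat: "\<And>i. \<not> (s i = b \<and> s (Suc i) = b \<and> s (Suc (Suc i)) = (\<not> b) \<and>
      s (Suc (Suc (Suc i))) = (\<not> b))"
  shows "f (Suc (Suc (Suc j))) \<noteq> y1"
proof
  note nbf = cycle_copy_neighbours[OF ori f l]
  have fwd: "s i = b" if "f i = p" "f (Suc i) = q" "arc_dir A b p q" for i p q
    using arc_dir_unique[OF ori, of "s i" p q b] f that by (auto simp: cycle_copy_def)
  have bwd: "s i = (\<not> b)" if "f i = q" "f (Suc i) = p" "arc_dir A b p q" for i p q
    using arc_dir_unique[OF ori, of "s i" q p "\<not> b"] f that
    by (auto simp: cycle_copy_def arc_dir_flip)
  assume hit: "f (Suc (Suc (Suc j))) = y1"
  then consider
    "f (Suc (Suc j)) = z1" "f (Suc (Suc (Suc (Suc j)))) = x" |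
    "f (Suc (Suc j)) = x" "f (Suc (Suc (Suc (Suc j)))) = z1"
    using nbf[of "Suc (Suc j)"] nb by auto
  then show False
  proof cases
    case 1
    have s: "s (Suc (Suc j)) = b" "s (Suc (Suc (Suc j))) = b"
      using fwd 1 hit arcs by blast+
    consider "f (Suc (Suc (Suc (Suc (Suc j))))) = w" | "f (Suc (Suc (Suc (Suc (Suc j))))) = y2"
      using nbf[of "Suc (Suc (Suc j))"] nb 1 hit by auto
    then show False
    proof cases
      case w: 1
      have "s (Suc (Suc (Suc (Suc j)))) = b" using fwd 1 w arcs by blast
      then show False using s no3[of "Suc (Suc j)"] by simp
    next
      case y: 2
      have "f (Suc (Suc (Suc (Suc (Suc (Suc j)))))) = z2"
        using nbf[of "Suc (Suc (Suc (Suc j)))"] nb 1 y by auto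
      then have "s (Suc (Suc (Suc (Suc j)))) = (\<not> b)" "s (Suc (Suc (Suc (Suc (Suc j))))) = (\<not> b)"
        using bwd 1 y arcs by blast+
      then show False using s nopat[of "Suc (Suc j)"] by simp
    qed
  next
    case 2
    have s: "s (Suc (Suc j)) = (\<not> b)" "s (Suc (Suc (Suc j))) = (\<not> b)"
      using bwd 2 hit arcs by blast+
    consider "f (Suc j) = w" | "f (Suc j) = y2"
      using nbf[of "Suc j"] nb 2 hit by auto
    then show False
    proof cases
      case w: 1
      have "s (Suc j) = (\<not> b)" using bwd 2 w arcs by blast
      then show False using s no3[of "Suc j"] by simp
    next
      case y: 2
      have "f j = z2" using nbf[of j] nb 2 y by auto
      then have "s j = b" "s (Suc j) = b" using fwd 2 y arcs by blast+
      then show False using s nopat[of j] by simp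
    qed
  qed
qed

text \<open>A copy misses \<open>y1\<close> and, exchanging the two arms, also \<open>y2\<close>.
  Then it misses \<open>x\<close>, where only the neighbour \<open>w\<close> is left.\<close>

lemma extend_tee:
  assumes G: "simple_graph (V, E)" and l: "l \<ge> 3"
    and nb: "neighbours E y1 = {x, z1}" "neighbours E y2 = {x, z2}" "neighbours E x = {y1, y2, w}"
    and ne: "y1 \<noteq> y2" "w \<noteq> y1" "w \<noteq> y2" "z1 \<noteq> x" "z2 \<noteq> x" "z1 \<noteq> y2" "z2 \<noteq> y1"
    and no3: "\<And>i. \<not> (s i = s (Suc i) \<and> s i = s (Suc (Suc i)))"
    and nopat: "\<And>i. \<not> (s i = b \<and> s (Suc i) = b \<and> s (Suc (Suc i)) = (\<not> b) \<and>
      s (Suc (Suc (Suc i))) = (\<not> b))"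
    and A': "orientation_of (V - {x, y1, y2}, A') (V - {x, y1, y2}, {e \<in> E. e \<inter> {x, y1, y2} = {}})"
      "\<And>f. \<not> cycle_copy A' l s f"
  shows "\<exists>A. orientation_of (V, A) (V, E) \<and> (\<forall>f. \<not> cycle_copy A l s f)"
proof -
  define P where "P = {(z1, y1), (y1, x), (z2, y2), (y2, x), (x, w)}"
  \<comment> \<open>\<open>b\<close> selects the tee or its reversal, according to the pattern that
    the cycle lacks.\<close>
  define B where "B = (if b then P else P\<inverse>)"
  have e: "{z1, y1} \<in> E" "{y1, x} \<in> E" "{z2, y2} \<in> E" "{y2, x} \<in> E" "{x, w} \<in> E"
    using nb unfolding neighbours_def by (auto simp: insert_commute)
  note d = edge_distinct[OF G e(1)] edge_distinct[OF G e(2)] edge_distinct[OF G e(3)]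
    edge_distinct[OF G e(4)] edge_distinct[OF G e(5)]
  have P: "{p, q} \<in> E \<and> {p, q} \<inter> {x, y1, y2} \<noteq> {} \<and> (q, p) \<notin> P" if "(p, q) \<in> P" for p q
    using that e d ne unfolding P_def by auto
  have cover: "(p, q) \<in> P \<or> (q, p) \<in> P" if "{p, q} \<in> E" "q \<in> {x, y1, y2}" for p q
  proof -
    have "p \<in> neighbours E q" using that by (simp add: neighbours_def)
    then show ?thesis using that nb unfolding P_def by auto
  qed
  show ?thesis
  proof (rule extend_avoiding[OF A', where B = B])
    fix p q assume "(p, q) \<in> B"
    then show "{p, q} \<in> E \<and> {p, q} \<inter> {x, y1, y2} \<noteq> {} \<and> (q, p) \<notin> B"
      using P[of p q] P[of q p] by (auto simp: B_def insert_commute split: if_splits)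
  next
    fix p q assume "{p, q} \<in> E" "q \<in> {x, y1, y2}"
    then show "(p, q) \<in> B \<or> (q, p) \<in> B" using cover[of p q] by (auto simp: B_def)
  next
    fix f j assume ori: "orientation_of (V, A' \<union> B) (V, E)" and f: "cycle_copy (A' \<union> B) l s f"
      and hit: "f (Suc (Suc (Suc j))) \<in> {x, y1, y2}"
    have arcs: "arc_dir (A' \<union> B) b p q" if "(p, q) \<in> P" for p q
      using that by (simp add: arc_dir_def B_def)
    have y1: "f (Suc (Suc (Suc i))) \<noteq> y1" for i
      by (rule copy_misses_tee[where b = b and s = s, OF ori f l nb _ _ _ _ _ no3 nopat]) (auto intro!: arcs simp: P_def)
    have y2: "f (Suc (Suc (Suc i))) \<noteq> y2" for i
      by (rule copy_misses_tee[where b = b and s = s, OF ori f l nb(2,1) _ _ _ _ _ _ no3 nopat])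
        (auto intro!: arcs simp: P_def nb(3))
    have n1: "f i \<noteq> y1" and n2: "f i \<noteq> y2" for i
      using cycle_copy_late[OF f l, of i] y1 y2 by metis+
    have "f (Suc (Suc (Suc j))) = x" using hit y1 y2 by simp
    then show False
      using cycle_copy_neighbours[OF ori f l, of "Suc (Suc j)"] nb(3) n1 n2 by auto
  qed (use l in simp)
qed

section \<open>Unavoidable configurations and the induction\<close>

lemma card_two_other:
  assumes "card N = 2" "a \<in> N"
  obtains b where "N = {b, a}" "b \<noteq> a"
  using assms by (auto simp: card_2_iff)

text \<open>If none of the three occurs, discharging contradicts sparseness. The case
  \<open>tee\<close> also records that vertices of degree two are pairwise nonadjacent, which keeps
  its two arms apart.\<close>

lemma sparse_configuration:
  assumes G: "simple_graph (V, E)" and sp: "sparse k V E" and V: "V \<noteq> {}" and k: "k = 3 \<or> k = 5"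
  obtains
    (low) v where "v \<in> V" "card (neighbours E v) \<le> 1"
  | (pair) u v where "{u, v} \<in> E" "card (neighbours E u) = 2" "card (neighbours E v) = 2"
  | (tee) x where "k = 3" "x \<in> V" "card (neighbours E x) = 3"
      "card {u \<in> neighbours E x. card (neighbours E u) = 2} \<ge> 2"
      "\<And>u v. {u, v} \<in> E \<Longrightarrow> card (neighbours E u) = 2 \<Longrightarrow> card (neighbours E v) \<noteq> 2"
proof (rule ccontr)
  assume neg: "\<not> thesis"
  let ?n = "\<lambda>v. card {u \<in> neighbours E v. card (neighbours E u) = 2}"
  have indep: "card (neighbours E v) \<noteq> 2" if "{u, v} \<in> E" "card (neighbours E u) = 2" for u v
    using neg pair that by blast
  have "(k + 1) * card V \<le> k * card E"
  proof (rule discharge_degree_two[OF G indep])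
    fix v assume v: "v \<in> V" "card (neighbours E v) \<noteq> 2"
    then have d: "card (neighbours E v) \<ge> 3" using neg low[of v] by linarith
    have n: "?n v \<le> card (neighbours E v)"
      by (intro card_mono finite_neighbours[OF G]) auto
    show "?n v + (2 * k + 2) \<le> k * card (neighbours E v)"
    \<comment> \<open>Let d be the degree. Even if all d neighbours have degree two, (k - 1) d >= 2k
      + 2 suffices; it is tight at k = 5, d = 3 and at k = 3, d = 4. For k = d = 3 at most one such
      neighbour is affordable, hence the case \<open>tee\<close>.\<close>
    proof (cases "k = 3 \<and> card (neighbours E v) = 3")
      case True
      then have "\<not> 2 \<le> ?n v" using neg tee[of v] v(1) indep by blast
      then show ?thesis using True by simp
    next
      case False
      then show ?thesis using k n d by auto
    qed
  qed
  then show False using sparse_whole[OF G sp V] by simp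
qed

text \<open>Induction on the number of vertices; deletion preserves sparseness. \<open>nopat\<close>
  is conditional on \<open>k = 3\<close>, the only value for which \<open>tee\<close>
  arises.\<close>

lemma short_blocks_avoidable:
  assumes "simple_graph (V, E)" "sparse k V E"
    and l: "l \<ge> 3" and k: "k = 3 \<or> k = 5"
    and no3: "\<And>i. \<not> (s i = s (Suc i) \<and> s i = s (Suc (Suc i)))"
    and nopat: "k = 3 \<Longrightarrow> \<exists>b. \<forall>i. \<not> (s i = b \<and> s (Suc i) = b \<and> s (Suc (Suc i)) = (\<not> b) \<and>
      s (Suc (Suc (Suc i))) = (\<not> b))"
  shows "\<exists>A. orientation_of (V, A) (V, E) \<and> (\<forall>f. \<not> cycle_copy A l s f)"
  using assms(1,2)
proof (induction "card V" arbitrary: V E rule: less_induct)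
  case less
  note G = less.prems(1) and sp = less.prems(2)
  have fin: "finite V" using G by (simp add: simple_graph_def)
  have IH: "\<exists>A'. orientation_of (V - X, A') (V - X, {e \<in> E. e \<inter> X = {}}) \<and>
      (\<forall>f. \<not> cycle_copy A' l s f)" if "X \<inter> V \<noteq> {}" for X
  proof (rule less.hyps[OF _ simple_graph_delete[OF G] sparse_delete[OF sp]])
    show "card (V - X) < card V" using that fin by (intro psubset_card_mono) auto
  qed
  show ?case
  proof (cases "V = {}")
    case True
    then have E: "E = {}" using G by (force simp: simple_graph_def)
    have "orientation_of (V, {}) (V, E)" by (simp add: orientation_of_def E)
    moreover have "\<not> cycle_copy {} l s f" for f by (simp add: cycle_copy_def arc_dir_def)
    ultimately show ?thesis by blast
  next
    case False
    from G sp False k show ?thesis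
    proof (cases rule: sparse_configuration)
      case (low v)
      then show ?thesis using IH[of "{v}"] extend_degree_one[OF G l, of v] by auto
    next
      case (pair v1 v2)
      have "v2 \<in> neighbours E v1" "v1 \<in> neighbours E v2"
        using pair(1) by (simp_all add: neighbours_def insert_commute)
      then obtain u w where uw: "neighbours E v1 = {u, v2}" "u \<noteq> v2" "neighbours E v2 = {w, v1}" "w \<noteq> v1"
        using card_two_other pair by metis
      have "neighbours E v2 = {v1, w}" using uw by auto
      moreover have "{v1, v2} \<inter> V \<noteq> {}" using edge_in_verts[OF G pair(1)] by simp
      moreover from IH[OF this] obtain A' where "orientation_of (V - {v1, v2}, A')
          (V - {v1, v2}, {e \<in> E. e \<inter> {v1, v2} = {}})" "\<And>f. \<not> cycle_copy A' l s f" by blast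
      ultimately show ?thesis
        by (intro extend_degree_two_pair[where s = s, OF G l uw(1) _ uw(2,4) no3])
    next
      case (tee x)
      let ?T = "{u \<in> neighbours E x. card (neighbours E u) = 2}"
      obtain Y where Y: "Y \<subseteq> ?T" "card Y = 2" using obtain_subset_with_card_n[OF tee(4)] by blast
      then obtain y1 y2 where y: "Y = {y1, y2}" "y1 \<noteq> y2" by (auto simp: card_2_iff)
      have nx: "y1 \<in> neighbours E x" "y2 \<in> neighbours E x" and
        dy: "card (neighbours E y1) = 2" "card (neighbours E y2) = 2" using Y y by auto
      have "card (neighbours E x - {y1, y2}) = 1"
        using tee(3) nx y(2) by (simp add: card_Diff_subset)
      then obtain w where "neighbours E x - {y1, y2} = {w}" by (rule card_1_singletonE)
      then have w: "neighbours E x = {y1, y2, w}" "w \<noteq> y1" "w \<noteq> y2" using nx by auto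
      have "x \<in> neighbours E y1" "x \<in> neighbours E y2"
        using nx by (simp_all add: neighbours_def insert_commute)
      then obtain z1 z2 where z: "neighbours E y1 = {z1, x}" "z1 \<noteq> x"
        "neighbours E y2 = {z2, x}" "z2 \<noteq> x"
        using card_two_other dy by metis
      have nb: "neighbours E y1 = {x, z1}" "neighbours E y2 = {x, z2}" using z by auto
      have "{z1, y1} \<in> E" "{z2, y2} \<in> E" using z by (auto simp: neighbours_def)
      then have zy: "z1 \<noteq> y2" "z2 \<noteq> y1" using tee(5) dy by blast+
      obtain b where b: "\<And>i. \<not> (s i = b \<and> s (Suc i) = b \<and> s (Suc (Suc i)) = (\<not> b) \<and>
          s (Suc (Suc (Suc i))) = (\<not> b))" using nopat[OF tee(1)] by blast
      have "{x, y1, y2} \<inter> V \<noteq> {}" using tee(2) by simp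
      from IH[OF this] obtain A' where A': "orientation_of (V - {x, y1, y2}, A')
          (V - {x, y1, y2}, {e \<in> E. e \<inter> {x, y1, y2} = {}})" "\<And>f. \<not> cycle_copy A' l s f"
        by blast
      show ?thesis
        by (rule extend_tee[OF G l nb w(1) y(2) w(2,3) z(2,4) zy no3 b A'])
    qed
  qed
qed

text \<open>Having the pattern for both values of \<open>b\<close> takes three blocks of length two (two only if \<open>l = 4\<close>). The number
  of blocks is even, so the cycle would have at least seven edges.\<close>

lemma short_cycle_pattern:
  assumes l: "l = 5 \<or> l = 6" and per: "\<And>i. s (i + l) = s i"
    and no3: "\<And>i. \<not> (s i = s (Suc i) \<and> s i = s (Suc (Suc i)))"
  shows "\<exists>b. \<forall>i. \<not> (s i = b \<and> s (Suc i) = b \<and> s (Suc (Suc i)) = (\<not> b) \<and>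
    s (Suc (Suc (Suc i))) = (\<not> b))"
proof (rule ccontr)
  assume "\<not> ?thesis"
  then have ex: "\<exists>i. s i = b \<and> s (Suc i) = b \<and> s (Suc (Suc i)) = (\<not> b) \<and>
    s (Suc (Suc (Suc i))) = (\<not> b)" for b by blast
  obtain i where i: "s i" "s (Suc i)" "\<not> s (Suc (Suc i))" "\<not> s (Suc (Suc (Suc i)))"
    using ex[of True] by auto
  obtain j where j: "\<not> s j" "\<not> s (Suc j)" "s (Suc (Suc j))" "s (Suc (Suc (Suc j)))"
    using ex[of False] by auto
  have per': "s (a + n * l) = s a" for a n
  proof (induction n)
    case (Suc n)
    have "s (a + Suc n * l) = s (a + n * l + l)" by (simp add: ac_simps)
    then show ?case using Suc per by simp
  qed simp
  \<comment> \<open>Shifting by \<open>i\<close> puts the first pattern at 0. It turns out that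
    \<open>l = 6\<close> and that one period of \<open>t\<close> is + + - - + -, which does not
    contain - - + + cyclically.\<close>
  define t where "t a = s (i + a)" for a
  have t4: "t 4" using no3[of "i + 2"] i by (simp add: t_def eval_nat_numeral)
  have pt: "t (a + l) = t a" for a using per[of "i + a"] by (simp add: t_def add.assoc)
  have t0: "t 0" "t 1" "\<not> t 2" "\<not> t 3" using i by (simp_all add: t_def eval_nat_numeral)
  have no3t: "\<not> (t a = t (a + 1) \<and> t a = t (a + 2))" for a using no3[of "i + a"] by (simp add: t_def)
  \<comment> \<open>For \<open>l = 5\<close> the positions 4, 5, 6 would all be true, since 5 and 6
    repeat 0 and 1.\<close>
  have l6: "l = 6"
    using l pt[of 0] pt[of 1] no3t[of 4] t0 t4 by (auto simp: numeral_eq_Suc)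
  have t5: "\<not> t 5" using no3t[of 4] pt[of 0] t0 t4 l6 by (auto simp: numeral_eq_Suc)
  have tmod: "t a = t (a mod 6)" for a
    using per'[of "i + a mod 6" "a div 6"] l6 by (simp add: t_def add.assoc)
  \<comment> \<open>\<open>i * 5\<close> stands for the negative of \<open>i\<close> modulo 6, so
    \<open>r\<close> is the offset of \<open>j\<close> from \<open>i\<close>.\<close>
  define r where "r = j + i * 5"
  have tr: "t (r + n) = s (j + n)" for n
  proof -
    have "i + (r + n) = (j + n) + i * l" by (simp add: r_def l6)
    then show ?thesis using per'[of "j + n" i] unfolding t_def by metis
  qed
  define q where "q = r mod 6"
  have tq: "t ((q + n) mod 6) = s (j + n)" for n
    using tr[of n] tmod[of "r + n"] unfolding q_def mod_add_left_eq by simp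
  have "s (j + 0) = False" "s (j + 1) = False" "s (j + 2) = True" "s (j + 3) = True"
    using j by (simp_all add: numeral_eq_Suc)
  then have q: "\<not> t ((q + 0) mod 6)" "\<not> t ((q + 1) mod 6)" "t ((q + 2) mod 6)" "t ((q + 3) mod 6)"
    unfolding tq by simp_all
  have "q < 6" by (simp add: q_def)
  then consider "q = 0" | "q = 1" | "q = 2" | "q = 3" | "q = 4" | "q = 5" by linarith
  then show False by cases (use q t0 t4 t5 in simp_all)
qed

section \<open>From densities to sparseness\<close>

lemma finite_subgraphs:
  assumes "simple_graph G"
  shows "finite {J. subgraph J G}"
proof (rule finite_subset)
  show "{J. subgraph J G} \<subseteq> Pow (verts G) \<times> Pow (edges G)"
    by (auto simp: subgraph_def)
  show "finite (Pow (verts G) \<times> Pow (edges G))"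
    using assms finite_edges[of "verts G" "edges G"] by (simp add: simple_graph_def)
qed

lemma density_le_max_density:
  assumes G: "simple_graph G" and J: "subgraph J G" "card (verts J) \<ge> 1"
  shows "real (card (edges J)) / real (card (verts J)) \<le> max_density G"
  unfolding max_density_def
proof (rule Max_ge)
  show "finite {real (card (edges J)) / real (card (verts J)) |J. subgraph J G \<and> card (verts J) \<ge> 1}"
    by (rule finite_subset[OF _ finite_imageI[OF finite_subgraphs[OF G],
          of "\<lambda>J. real (card (edges J)) / real (card (verts J))"]]) blast
qed (use J in blast)

lemma simple_cycle_graph:
  assumes "l \<ge> 2"
  shows "simple_graph (cycle_graph l)"
proof -
  have "i \<noteq> (i + 1) mod l" if "i < l" for i
    using that assms by (cases "i + 1 = l") auto
  then show ?thesis using assms by (auto simp: simple_graph_def cycle_graph_def card_insert_if)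
qed

text \<open>Each edge is charged to its initial vertex on the cycle, which lies in
  \<open>W'\<close>. Either \<open>W\<close> is closed under successors and hence everything, or
  there are fewer edges than vertices and the quotient is at most 1.\<close>

lemma max_2_density_cycle_le:
  assumes l: "l \<ge> 3"
  shows "max_2_density (cycle_graph l) \<le> (real l - 1) / (real l - 2)"
proof -
  let ?d = "\<lambda>J :: nat graph. (real (card (edges J)) - 1) / (real (card (verts J)) - 2)"
  let ?M = "{?d J |J. subgraph J (cycle_graph l) \<and> card (verts J) \<ge> 3}"
  have G: "simple_graph (cycle_graph l)" using l by (intro simple_cycle_graph) simp
  have "finite ?M"
    by (rule finite_subset[OF _ finite_imageI[OF finite_subgraphs[OF G], of ?d]]) blast
  moreover have "?d (cycle_graph l) \<in> ?M"
    using G l by (force simp: subgraph_def cycle_graph_def)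
  moreover have "?d J \<le> (real l - 1) / (real l - 2)"
    if J: "subgraph J (cycle_graph l)" "card (verts J) \<ge> 3" for J
  proof -
    define W where "W = verts J"
    define W' where "W' = {i \<in> W. (i + 1) mod l \<in> W}"
    have W: "W \<subseteq> {..<l}" "finite W" "W' \<subseteq> W" "W \<noteq> {}" "finite W'"
      using J by (auto simp: W_def W'_def subgraph_def simple_graph_def cycle_graph_def)
    have "edges J \<subseteq> (\<lambda>i. {i, (i + 1) mod l}) ` W'"
    proof
      fix e assume "e \<in> edges J"
      then have "e \<in> edges (cycle_graph l)" "e \<subseteq> W"
        using J by (auto simp: subgraph_def simple_graph_def W_def)
      then show "e \<in> (\<lambda>i. {i, (i + 1) mod l}) ` W'" by (auto simp: cycle_graph_def W'_def)
    qed
    then have le: "card (edges J) \<le> card W'"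
      using W by (meson card_image_le card_mono finite_imageI le_trans)
    show ?thesis
    proof (cases "W' = W")
      case True
      have closed: "(i + n) mod l \<in> W" if "i \<in> W" for i n
      proof (induction n)
        case 0
        then show ?case using that W by auto
      next
        case (Suc n)
        then have "((i + n) mod l + 1) mod l \<in> W" using True by (auto simp: W'_def)
        then show ?case by (simp add: mod_Suc_eq)
      qed
      obtain i where i: "i \<in> W" using W by auto
      have "a \<in> W" if "a < l" for a
      proof -
        have "(i + (a + l - i)) mod l = a" using that i W by (auto simp: subset_iff)
        then show ?thesis using closed[OF i] by metis
      qed
      then have "W = {..<l}" using W by auto
      then have "card W = l" by simp
      moreover have "card (edges J) \<le> l" using le True calculation by simp
      ultimately show ?thesis using l unfolding W_def by (intro frac_le) auto
    next
      case False
      then have "card W' < card W" using W by (intro psubset_card_mono) auto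
      then have "?d J \<le> 1" using le J(2) by (simp add: W_def divide_le_eq)
      also have "1 \<le> (real l - 1) / (real l - 2)" using l by (simp add: le_divide_eq)
      finally show ?thesis .
    qed
  qed
  ultimately show ?thesis unfolding max_2_density_def by (subst Max_le_iff) auto
qed

text \<open>The quotient (l - 1) / (l - 2) decreases in \<open>l\<close> and equals (k + 1) / k at
  \<open>l = k + 2\<close>.\<close>

lemma sparse_from_density:
  assumes l: "l \<ge> k + 2" "k \<ge> 1" and G: "simple_graph G"
    and dens: "max_density G < max_2_density (cycle_graph l)"
  shows "sparse k (verts G) (edges G)"
  unfolding sparse_def
proof (intro allI impI)
  fix S assume S: "S \<subseteq> verts G" "S \<noteq> {}"
  let ?J = "(S, {e \<in> edges G. e \<subseteq> S})"
  have fS: "finite S" using S G by (auto simp: simple_graph_def intro: finite_subset)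
  then have c: "card S \<ge> 1" using S by (simp add: Suc_le_eq card_gt_0_iff)
  have "subgraph ?J G" using S fS G by (auto simp: subgraph_def simple_graph_def)
  then have "real (card {e \<in> edges G. e \<subseteq> S}) / real (card S) \<le> max_density G"
    using density_le_max_density[OF G, of ?J] c by simp
  also have "\<dots> < (real l - 1) / (real l - 2)"
    using dens max_2_density_cycle_le[of l] l by simp
  also have "\<dots> \<le> (real k + 1) / real k"
  proof -
    have "real k + 2 \<le> real l" using l by linarith
    moreover from this have "(real l - 1) * real k \<le> (real k + 1) * (real l - 2)"
      by (simp add: algebra_simps)
    ultimately show ?thesis using l by (simp add: frac_le_eq divide_le_eq le_divide_eq)
  qed
  finally have "real (card {e \<in> edges G. e \<subseteq> S}) * real k < (real k + 1) * real (card S)"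
    using c l by (simp add: divide_less_eq less_divide_eq mult.commute)
  then have "real (k * card {e \<in> edges G. e \<subseteq> S}) < real ((k + 1) * card S)"
    by (simp add: algebra_simps)
  then show "k * card {e \<in> edges G. e \<subseteq> S} < (k + 1) * card S" by linarith
qed

section \<open>Unrolling copies and the final case distinction\<close>

text \<open>The embedding is read modulo \<open>l\<close>. Where the forward arc of \<open>C\<close>
  is absent, the orientation supplies the backward one.\<close>

lemma cycle_copy_of_contains_copy:
  assumes l: "l \<ge> 3" and C: "orientation_of C (cycle_graph l)" and c: "contains_copy (V, A) C"
  shows "\<exists>f. cycle_copy A l (\<lambda>i. (i mod l, Suc i mod l) \<in> arcs C) f"
proof -
  have dC: "dverts C = {..<l}" using C by (simp add: orientation_of_def cycle_graph_def)
  obtain g where g: "inj_on g {..<l}" "\<And>u v. (u, v) \<in> arcs C \<Longrightarrow> (g u, g v) \<in> A"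
    using c unfolding contains_copy_def dC by fastforce
  have "arc_dir A ((i mod l, Suc i mod l) \<in> arcs C) (g (i mod l)) (g (Suc i mod l))" for i
  proof -
    have "{i mod l, (i mod l + 1) mod l} \<in> edges (cycle_graph l)"
      using l unfolding cycle_graph_def by auto
    then have "{i mod l, Suc i mod l} \<in> edges (cycle_graph l)" by (simp add: mod_Suc_eq)
    then have "(i mod l, Suc i mod l) \<in> arcs C \<longleftrightarrow> (Suc i mod l, i mod l) \<notin> arcs C"
      using C unfolding orientation_of_def by blast
    then show ?thesis using g(2) by (auto simp: arc_dir_def)
  qed
  moreover have "inj_on (\<lambda>i. g (i mod l)) {..<l}"
    using g(1) by (auto simp: inj_on_def)
  ultimately have "cycle_copy A l (\<lambda>i. (i mod l, Suc i mod l) \<in> arcs C) (\<lambda>i. g (i mod l))"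
    by (simp add: cycle_copy_def)
  then show ?thesis by blast
qed

theorem theorem17:
  fixes l :: nat and C :: "nat digraph" and G :: "'a graph"
  assumes "l \<ge> 5"
    and "orientation_of C (cycle_graph l)"
    and "simple_graph G"
    and "max_density G < max_2_density (cycle_graph l)"
  shows "\<not> arrows G C"
proof -
  obtain V E where VE: "G = (V, E)" by (cases G)
  have G: "simple_graph (V, E)" using assms(3) VE by simp
  have sp: "sparse k V E" if "k + 2 \<le> l" "k \<ge> 1" for k
    using sparse_from_density[OF that assms(3,4)] VE by simp
  define s where "s i \<longleftrightarrow> (i mod l, Suc i mod l) \<in> arcs C" for i
  have per: "s (i + l) = s i" for i
    unfolding s_def by (metis add_Suc mod_add_self2)
  have "\<exists>A. orientation_of (V, A) (V, E) \<and> (\<forall>f. \<not> cycle_copy A l s f)"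
  proof (cases "\<exists>i. s i = s (Suc i) \<and> s i = s (Suc (Suc i))")
    case True
    then show ?thesis using long_block_avoidable[OF G sp[of 3]] assms(1) by auto
  next
    case False
    show ?thesis
    proof (cases "l \<ge> 7")
      case True
      \<comment> \<open>As \<open>l \<ge> 7\<close>, sparseness holds with \<open>k = 5\<close>, for
        which no tee arises.\<close>
      then show ?thesis using False by (intro short_blocks_avoidable[OF G sp[of 5]]) auto
    next
      case l: False
      then have "l = 5 \<or> l = 6" using assms(1) by auto
      then have "\<exists>b. \<forall>i. \<not> (s i = b \<and> s (Suc i) = b \<and> s (Suc (Suc i)) = (\<not> b) \<and>
          s (Suc (Suc (Suc i))) = (\<not> b))"
        using per False by (intro short_cycle_pattern[of l s]) blast+
      then show ?thesis
        using False assms(1) by (intro short_blocks_avoidable[OF G sp[of 3]]) auto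
    qed
  qed
  then obtain A where A: "orientation_of (V, A) (V, E)" "\<And>f. \<not> cycle_copy A l s f" by blast
  have "\<not> contains_copy (V, A) C"
    using cycle_copy_of_contains_copy[of l C V A] A(2) assms(1,2) unfolding s_def by auto
  then show ?thesis using A(1) unfolding arrows_def VE by blast
qed

end
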